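(* Let $d\ge2$ be an integer and $c\in\mathbb{C}$ such that $f(x)=x^d+c$ is not linearly conjugate to $x^d$ or to $\pm T_d(x)$ (equivalently $c\neq0$, and $c\neq-2$ if $d=2$). For each positive divisor $\delta$ of $d$ let $f_\delta(x)=(x^\delta+c)^{d/\delta}$. Fix a positive integer $n$. Then every pair of non-constant polynomials $A,B\in\mathbb{C}[x]$ with $f^n\circ A=A\circ B$ has the form $A=f^m\circ(x^\delta+c)\circ L$ and $B=L^{-1}\circ f_\delta^n\circ L$ for some integer $m\ge0$, some positive divisor $\delta$ of $d$, and some linear polynomial $L$.
   Context: $T_d$ is the Chebyshev polynomial of degree $d$ ($T_d(z+1/z)=z^d+1/z^d$). Polynomials $f,g$ are linearly conjugate if $f=\eta^{-1}\circ g\circ\eta$ for a linear polynomial $\eta$. $f^m$ denotes the $m$-th iterate, $f^0=\mathrm{id}$. *)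

theory Defs
  imports "HOL-Computational_Algebra.Polynomial"
begin

definition piter :: "'a::comm_semiring_1 poly \<Rightarrow> nat \<Rightarrow> 'a poly" where
  "piter f m = (pcompose f ^^ m) [:0, 1:]"

end

theory Submission
  imports Defs "HOL-Computational_Algebra.Fundamental_Theorem_Algebra"
begin

text \<open>
  From \<open>f\<^sup>n \<circ> A = A \<circ> B\<close> the polynomial \<open>(A - c) \<circ> B\<close> is a \<open>d\<close>-th power. Counting
  ramification of \<open>B\<close>, at most one root \<open>\<alpha>\<close> of \<open>A - c\<close> has multiplicity not divisible
  by \<open>d\<close>, so \<open>A - c = (x - \<alpha>)\<^sup>k Q\<^sup>d\<close>. If \<open>k = 0\<close>, then \<open>A = f \<circ> A\<^sub>1\<close> with \<open>A\<^sub>1\<close>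
  again a solution. Otherwise put \<open>g = gcd d k\<close> and \<open>e = d/g\<close>: then \<open>B - \<alpha>\<close> is an \<open>e\<close>-th power
  and \<open>A \<circ> (x\<^sup>e + \<alpha>) = f \<circ> P\<close>, where \<open>P = x\<^bsup>k/g\<^esup> Q(x\<^sup>e + \<alpha>)\<close> is, up to a root of unity, a
  solution of degree \<open>deg A / g\<close>. For \<open>g > 1\<close> induction on the degree applies to \<open>P\<close>, and
  its rotational symmetry forces \<open>P\<close> to be linear, whence \<open>A = (x\<^sup>g + c) \<circ> L\<close>. For \<open>g = 1\<close>
  the solution \<open>P\<close> is strongly ramified over each \<open>\<eta>c\<close> with \<open>\<eta>\<^sup>d = 1\<close>; this is too
  much ramification unless \<open>A\<close> is linear or \<open>d = 2\<close>, and in the latter case lifting once more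
  shows \<open>c = -2\<close>.
\<close>

section \<open>Ramification and powers\<close>

lemma diff_const_nonzero:
  fixes p :: "'a::comm_ring poly"
  assumes "degree p > 0"
  shows "p - [:v:] \<noteq> 0"
  using assms by auto

lemma sum_fibre_order:
  fixes p :: "complex poly"
  assumes "degree p > 0"
  shows "(\<Sum>x | poly p x = v. order x (p - [:v:])) = degree p"
proof -
  let ?q = "p - [:v:]"
  have "?q \<noteq> 0" using assms by auto
  have "degree ?q = degree p"
    by (metis degree_add_eq_left add_uminus_conv_diff assms degree_minus degree_pCons_0)
  moreover have "{x. poly p x = v} = set_mset (proots ?q)"
    using \<open>?q \<noteq> 0\<close> by auto
  moreover have "(\<Sum>x\<in>set_mset (proots ?q). order x ?q) = size (proots ?q)"
    using \<open>?q \<noteq> 0\<close> by (simp add: size_multiset_overloaded_eq)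
  ultimately show ?thesis by (simp add: size_proots_complex)
qed

lemma finite_fibre:
  fixes p :: "complex poly"
  assumes "degree p > 0"
  shows "finite {x. poly p x = v}"
proof -
  have "p - [:v:] \<noteq> 0" using assms by auto
  from poly_roots_finite[OF this] show ?thesis by simp
qed

text \<open>The genus-zero Riemann--Hurwitz inequality, with both sides moved to avoid subtraction.\<close>

lemma card_fibres:
  fixes p :: "complex poly"
  assumes "degree p > 0" "finite V"
  shows "card V * degree p < (\<Sum>v\<in>V. card {x. poly p x = v}) + degree p"
proof -
  let ?F = "\<lambda>v. {x. poly p x = v}"
  have "pderiv p \<noteq> 0" using assms by (simp add: pderiv_eq_0_iff)
  \<comment> \<open>The order of the derivative at \<open>x\<close> is the multiplicity of
    \<open>x\<close> in its fibre minus one, so the defect of each fibre is a sum of zero orders of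
    \<open>pderiv p\<close>.\<close>
  have ord: "order x (p - [:poly p x:]) = Suc (order x (pderiv p))" for x
  proof -
    have "p - [:poly p x:] \<noteq> 0" using assms(1) by (rule diff_const_nonzero)
    from order_pderiv[OF this, of x] show ?thesis by (simp add: pderiv_diff pderiv_pCons)
  qed
  have deg: "degree p = card (?F v) + (\<Sum>x\<in>?F v. order x (pderiv p))" for v
  proof -
    have "degree p = (\<Sum>x\<in>?F v. order x (p - [:v:]))" using sum_fibre_order[OF assms(1)] by simp
    also have "\<dots> = (\<Sum>x\<in>?F v. Suc (order x (pderiv p)))" using ord by (intro sum.cong) auto
    finally show ?thesis by (simp add: sum_Suc)
  qed
  have "card V * degree p = (\<Sum>v\<in>V. degree p)" by simp
  also have "\<dots> = (\<Sum>v\<in>V. card (?F v) + (\<Sum>x\<in>?F v. order x (pderiv p)))"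
    using deg by (intro sum.cong) auto
  also have "\<dots> = (\<Sum>v\<in>V. card (?F v)) + (\<Sum>v\<in>V. \<Sum>x\<in>?F v. order x (pderiv p))"
    by (simp add: sum.distrib)
  also have "(\<Sum>v\<in>V. \<Sum>x\<in>?F v. order x (pderiv p)) = (\<Sum>x\<in>(\<Union>v\<in>V. ?F v). order x (pderiv p))"
    using assms finite_fibre[OF assms(1)] by (subst sum.UNION_disjoint) auto
  also have "\<dots> = (\<Sum>x | x \<in> (\<Union>v\<in>V. ?F v) \<and> poly (pderiv p) x = 0. order x (pderiv p))"
    using assms finite_fibre[OF assms(1)] \<open>pderiv p \<noteq> 0\<close>
    by (intro sum.mono_neutral_right) (auto simp: order_eq_0_iff)
  also have "\<dots> \<le> (\<Sum>x | poly (pderiv p) x = 0. order x (pderiv p))"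
    using \<open>pderiv p \<noteq> 0\<close> by (intro sum_mono2) (auto simp: poly_roots_finite)
  also have "\<dots> \<le> degree (pderiv p)" by (rule sum_order_le_degree[OF \<open>pderiv p \<noteq> 0\<close>])
  also have "\<dots> < degree p" using assms by (simp add: degree_pderiv)
  finally show ?thesis by simp
qed

lemma card_fibre_le:
  fixes p :: "complex poly"
  assumes "degree p > 0" "\<And>x. poly p x = v \<Longrightarrow> m \<le> order x (p - [:v:])"
  shows "m * card {x. poly p x = v} \<le> degree p"
proof -
  have "(\<Sum>x | poly p x = v. m) \<le> (\<Sum>x | poly p x = v. order x (p - [:v:]))"
    using assms by (intro sum_mono) auto
  then show ?thesis using sum_fibre_order[OF assms(1), of v] by (simp add: mult.commute)
qed

text \<open>Without a critical point over \<open>v\<close> all roots of \<open>p - [:v:]\<close> are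
  simple, and the fibre has \<open>degree p\<close> points.\<close>

lemma card_fibre_less_imp_critical:
  fixes p :: "complex poly"
  assumes "degree p > 0" "card {x. poly p x = v} < degree p"
  obtains x where "poly p x = v" "poly (pderiv p) x = 0"
proof -
  have "\<exists>x. poly p x = v \<and> poly (pderiv p) x = 0"
  proof (rule ccontr)
    assume *: "\<not> ?thesis"
    have "order x (p - [:v:]) = 1" if "poly p x = v" for x
    proof -
      have "p - [:v:] \<noteq> 0" using assms by auto
      from order_pderiv[OF this, of x] * that show ?thesis
        by (auto simp: pderiv_diff pderiv_pCons order_0I)
    qed
    then have "(\<Sum>x | poly p x = v. order x (p - [:v:])) = (\<Sum>x | poly p x = v. 1)"
      by (intro sum.cong) auto
    with sum_fibre_order[OF assms(1), of v] assms(2) show False by simp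
  qed
  with that show thesis by blast
qed

lemma card_fibre_critical:
  fixes p :: "complex poly"
  assumes "degree p > 0" "poly (pderiv p) x = 0"
  shows "card {y. poly p y = poly p x} < degree p"
proof -
  let ?v = "poly p x"
  have nz: "p - [:?v:] \<noteq> 0" using assms(1) by (rule diff_const_nonzero)
  have "pderiv p \<noteq> 0" using assms by (simp add: pderiv_eq_0_iff)
  have "(\<Sum>y | poly p y = ?v. 1) < (\<Sum>y | poly p y = ?v. order y (p - [:?v:]))"
  proof (rule sum_strict_mono_ex1)
    show "\<forall>y\<in>{y. poly p y = ?v}. 1 \<le> order y (p - [:?v:])"
      using nz by (auto simp: Suc_le_eq order_gt_0_iff)
    have "order x (p - [:?v:]) = Suc (order x (pderiv p))"
      using order_pderiv[OF nz, of x] by (simp add: pderiv_diff pderiv_pCons)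
    moreover have "order x (pderiv p) > 0"
      using \<open>pderiv p \<noteq> 0\<close> assms(2) by (simp add: order_gt_0_iff)
    ultimately show "\<exists>y\<in>{y. poly p y = ?v}. 1 < order y (p - [:?v:])" by auto
  qed (rule finite_fibre[OF assms(1)])
  with sum_fibre_order[OF assms(1), of ?v] show ?thesis by simp
qed

text \<open>Multiplication by \<open>w\<close> maps the fibre over \<open>v\<close> onto the one
  over \<open>w ^ k * v\<close>; this carries bounds on fibre sizes from one value to
  another.\<close>

lemma fibre_rotate:
  fixes P :: "complex poly"
  assumes rot: "\<And>x. poly P (w * x) = w ^ k * poly P x" and "w \<noteq> 0" "finite {x. poly P x = v}"
  shows "card {x. poly P x = w ^ k * v} \<le> card {x. poly P x = v}"
proof -
  have "{x. poly P x = w ^ k * v} \<subseteq> (*) w ` {x. poly P x = v}"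
  proof
    fix x assume "x \<in> {x. poly P x = w ^ k * v}"
    then have "poly P (w * (x / w)) = w ^ k * v" using \<open>w \<noteq> 0\<close> by simp
    then have "poly P (x / w) = v" using rot[of "x / w"] \<open>w \<noteq> 0\<close> by simp
    then show "x \<in> (*) w ` {x. poly P x = v}"
      using \<open>w \<noteq> 0\<close> by (intro image_eqI[of _ _ "x / w"]) auto
  qed
  then show ?thesis using assms(3) by (meson card_image_le card_mono finite_imageI order_trans)
qed

section \<open>Multiplicities of roots and perfect powers\<close>

lemma nth_power_if_dvd_orders:
  fixes p :: "complex poly"
  assumes "d > 0" "\<And>a. d dvd order a p"
  obtains q where "p = q ^ d"
proof -
  obtain r where r: "r ^ d = lead_coeff p" using nth_root_exists[OF assms(1)] by blast
  let ?q = "smult r (\<Prod>z | poly p z = 0. [:-z, 1:] ^ (order z p div d))"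
  have "?q ^ d = smult (lead_coeff p) (\<Prod>z | poly p z = 0. [:-z, 1:] ^ order z p)"
    using assms(2) by (simp add: smult_power r prod_power_distrib flip: power_mult)
  then show thesis using that[of ?q] complex_poly_decompose[of p] by simp
qed

lemma order_power_eq:
  fixes p :: "'a::idom poly"
  assumes "p \<noteq> 0"
  shows "order a (p ^ n) = n * order a p"
  using assms by (induction n) (auto simp: order_mult)

lemma pcompose_power:
  fixes p :: "'a::comm_semiring_1 poly"
  shows "pcompose (p ^ n) q = pcompose p q ^ n"
  by (induction n) (simp_all add: pcompose_mult pcompose_1)

text \<open>Split off from \<open>U\<close> its full power of the linear factor at
  \<open>poly V t\<close>. Composition turns this into the same power of
  \<open>V - [:poly V t:]\<close>, and the cofactor does not vanish at \<open>t\<close>.\<close>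

lemma order_pcompose:
  fixes U V :: "complex poly"
  assumes "U \<noteq> 0" "degree V > 0"
  shows "order t (pcompose U V) = order (poly V t) U * order t (V - [:poly V t:])"
proof -
  let ?v = "poly V t"
  obtain R where R: "U = [:- ?v, 1:] ^ order ?v U * R" "\<not> [:- ?v, 1:] dvd R"
    using order_decomp[OF assms(1)] by blast
  have lin: "pcompose [:- ?v, 1:] V = V - [:?v:]" by (simp add: pcompose_pCons)
  have nz: "V - [:?v:] \<noteq> 0" using assms(2) by (rule diff_const_nonzero)
  have R0: "poly R ?v \<noteq> 0" using R(2) by (simp add: poly_eq_0_iff_dvd)
  then have R1: "poly (pcompose R V) t \<noteq> 0" by (simp add: poly_pcompose)
  then have "pcompose R V \<noteq> 0" by auto
  have "pcompose U V = (V - [:?v:]) ^ order ?v U * pcompose R V"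
    using arg_cong[OF R(1), of "\<lambda>p. pcompose p V"] by (simp add: pcompose_mult pcompose_power lin)
  then show ?thesis
    using nz \<open>pcompose R V \<noteq> 0\<close> R1 by (simp add: order_mult order_power_eq order_0I)
qed

text \<open>A point \<open>\<alpha>\<close> whose multiplicity in \<open>U\<close> is not divisible by \<open>d\<close> forces every point of
  the fibre of \<open>V\<close> over \<open>\<alpha>\<close> to be ramified, and two such fibres would exceed the total
  ramification of \<open>V\<close>.\<close>

lemma pcompose_eq_power:
  fixes U V W :: "complex poly"
  assumes "d > 0" "U \<noteq> 0" "degree V > 0" "pcompose U V = W ^ d"
  obtains \<alpha> k Q X where "U = [:-\<alpha>, 1:] ^ k * Q ^ d"
    "k = 0 \<or> 0 < k \<and> k < d \<and> V = X ^ (d div gcd d k) + [:\<alpha>:]"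
proof -
  have "pcompose U V \<noteq> 0"
    using assms(2,3) by (metis pcompose_eq_0 )
  then have "W \<noteq> 0" using assms by (auto simp: power_0_left)
  have dvd: "d dvd order (poly V t) U * order t (V - [:poly V t:])" for t
    using order_pcompose[OF assms(2,3), of t] assms(4) order_power_eq[OF \<open>W \<noteq> 0\<close>, of t d]
    by (metis dvd_triv_left)
  \<comment> \<open>Write \<open>d = e * g\<close> and \<open>order \<alpha> U = j * g\<close> with
    \<open>e\<close>, \<open>j\<close> coprime: since \<open>d\<close> divides \<open>j * g\<close>
    times the multiplicity, \<open>e\<close> divides the multiplicity.\<close>
  have ram: "(d div gcd d (order \<alpha> U)) dvd order t (V - [:\<alpha>:])" for t \<alpha>
  proof (cases "poly V t = \<alpha>")
    case True
    then have "d dvd order \<alpha> U * order t (V - [:\<alpha>:])" using dvd[of t] by simp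
    moreover obtain g e j where g: "g = gcd d (order \<alpha> U)" and d: "d = e * g"
      and j: "order \<alpha> U = j * g" and "coprime e j"
      using gcd_coprime_exists[of d "order \<alpha> U"] assms(1)
      by (metis gcd_nat.neutr_eq_iff not_gr_zero)
    ultimately have "g * e dvd g * (j * order t (V - [:\<alpha>:]))"
      by (metis mult.assoc mult.commute)
    moreover have "g > 0" using d assms(1) by auto
    ultimately have "e dvd order t (V - [:\<alpha>:])"
      using \<open>coprime e j\<close> by (simp add: coprime_dvd_mult_right_iff)
    moreover have "d div g = e" using d \<open>g > 0\<close> by simp
    ultimately show ?thesis unfolding g by simp
  next
    case False
    then show ?thesis by (simp add: order_0I)
  qed
  have half: "2 * card {x. poly V x = \<alpha>} \<le> degree V" if "\<not> d dvd order \<alpha> U" for \<alpha>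
  proof (rule card_fibre_le[OF assms(3)])
    fix x assume x: "poly V x = \<alpha>"
    let ?e = "d div gcd d (order \<alpha> U)"
    have "?e \<noteq> 1" using that
      by (metis dvd_mult_div_cancel gcd_dvd1 gcd_dvd2 mult.right_neutral)
    moreover have "?e > 0" using assms(1) by (simp add: dvd_imp_le div_greater_zero_iff)
    ultimately have "2 \<le> ?e" by linarith
    moreover have "V - [:\<alpha>:] \<noteq> 0" using assms(3) by auto
    then have "order x (V - [:\<alpha>:]) > 0" using x by (simp add: order_gt_0_iff)
    ultimately show "2 \<le> order x (V - [:\<alpha>:])" using ram[of \<alpha> x] dvd_imp_le order_trans by blast
  qed
  \<comment> \<open>Two fibres of at most \<open>degree V / 2\<close> points each contradict
    \<open>card_fibres\<close>.\<close>
  have uniq: "\<alpha> = \<beta>" if "\<not> d dvd order \<alpha> U" "\<not> d dvd order \<beta> U" for \<alpha> \<beta>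
  proof (rule ccontr)
    assume "\<alpha> \<noteq> \<beta>"
    with card_fibres[OF assms(3), of "{\<alpha>, \<beta>}"] half[OF that(1)] half[OF that(2)]
    show False by simp
  qed
  show thesis
  proof (cases "\<forall>\<alpha>. d dvd order \<alpha> U")
    case True
    then obtain Q where "U = Q ^ d" using nth_power_if_dvd_orders[OF assms(1)] by blast
    then show thesis using that[of 0 0 Q] by simp
  next
    case False
    then obtain \<alpha> where \<alpha>: "\<not> d dvd order \<alpha> U" by blast
    \<comment> \<open>Only the residue modulo \<open>d\<close> is kept: the remaining multiple of
      \<open>d\<close> goes into \<open>Q ^ d\<close>, and the gcd with \<open>d\<close> does not
      change.\<close>
    define k where "k = order \<alpha> U mod d"
    have k: "0 < k" "k < d" using \<alpha> assms(1) by (auto simp: k_def mod_greater_zero_iff_not_dvd)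
    have "[:-\<alpha>, 1:] ^ k dvd U"
      by (rule power_le_dvd[OF order_1]) (simp add: k_def)
    then obtain R where R: "U = [:-\<alpha>, 1:] ^ k * R" by (elim dvdE)
    then have "R \<noteq> 0" using assms(2) by auto
    have "d dvd order a R" for a
    proof (cases "a = \<alpha>")
      case True
      have "order \<alpha> U = k + order \<alpha> R"
        using \<open>R \<noteq> 0\<close> by (simp add: R order_mult order_power_n_n)
      then show ?thesis using True
        by (metis k_def add_diff_cancel_left' minus_mod_eq_mult_div dvd_triv_left)
    next
      case False
      then have "order a U = order a R"
        using \<open>R \<noteq> 0\<close> by (simp add: R order_mult order_power_eq order_0I)
      then show ?thesis using False uniq[OF \<alpha>] by metis
    qed
    then obtain Q where Q: "R = Q ^ d" using nth_power_if_dvd_orders[OF assms(1)] by blast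
    have "gcd d (order \<alpha> U) = gcd d k" by (metis k_def gcd.commute gcd_red_nat)
    moreover have "d div gcd d k > 0" using assms(1) by (simp add: dvd_imp_le div_greater_zero_iff)
    ultimately obtain X where "V - [:\<alpha>:] = X ^ (d div gcd d k)"
      using nth_power_if_dvd_orders[of "d div gcd d k" "V - [:\<alpha>:]"] ram[of \<alpha>] by metis
    then have "V = X ^ (d div gcd d k) + [:\<alpha>:]" by (simp add: algebra_simps)
    then show thesis using that[of \<alpha> k Q X] R Q k by simp
  qed
qed

text \<open>At each point the values differ by some \<open>d\<close>-th root of unity. There are
  finitely many of these and infinitely many points, so one \<open>z\<close> serves infinitely many
  points and hence all.\<close>

lemma power_eq_power_poly:
  fixes p q :: "complex poly"
  assumes "d > 0" "p ^ d = q ^ d"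
  obtains z where "z ^ d = 1" "p = smult z q"
proof -
  let ?Z = "{z::complex. z ^ d = 1}"
  have "x \<in> (\<Union>z\<in>?Z. {x. poly (p - smult z q) x = 0})" for x
  proof -
    have eq: "poly p x ^ d = poly q x ^ d" using assms(2) by (metis poly_power)
    show ?thesis
    proof (cases "poly q x = 0")
      case True
      then show ?thesis using eq assms(1) by (auto simp: power_0_left intro!: exI[of _ 1])
    next
      case False
      then have "(poly p x / poly q x) ^ d = 1" using eq by (simp add: power_divide)
      then show ?thesis using False by (auto intro!: exI[of _ "poly p x / poly q x"])
    qed
  qed
  then have "(\<Union>z\<in>?Z. {x. poly (p - smult z q) x = 0}) = UNIV" by blast
  moreover have "finite ?Z" using assms(1) by (intro finite_roots_unity) auto
  ultimately obtain z where "z \<in> ?Z" "infinite {x. poly (p - smult z q) x = 0}"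
    by (metis (no_types, lifting) finite_UN infinite_UNIV_char_0)
  then show thesis using that[of z] poly_roots_finite[of "p - smult z q"] by auto
qed

lemma poly_piter: "poly (piter f m) x = (poly f ^^ m) x"
  unfolding piter_def by (induction m arbitrary: x) (simp_all add: poly_pcompose)

lemma degree_piter:
  fixes f :: "complex poly"
  shows "degree (piter f m) = degree f ^ m"
  unfolding piter_def by (induction m) (simp_all add: degree_pcompose)

text \<open>By Bezout the \<open>k\<close>-th power map permutes the \<open>e\<close>-th roots of
  unity: \<open>u\<close> gives surjectivity, the last clause a trivial kernel.\<close>

lemma root_of_unity_power_coprime:
  fixes w :: complex
  assumes "coprime k e" "k > 0" "w ^ e = 1"
  obtains u where "u ^ e = 1" "u ^ k = w" "w ^ k = 1 \<Longrightarrow> w = 1"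
proof -
  obtain x y where xy: "k * x = e * y + 1"
    using bezout_nat[of k e] assms by auto
  have w: "w ^ (k * x) = w" by (simp add: xy power_add power_mult assms)
  have "(w ^ x) ^ e = 1" using assms(3) by (metis mult.commute power_mult power_one)
  moreover have "(w ^ x) ^ k = w" using w by (metis mult.commute power_mult)
  moreover have "w = 1" if "w ^ k = 1" using w that by (simp add: power_mult)
  ultimately show thesis using that by blast
qed

section \<open>Solutions of the semiconjugacy equation\<close>

locale unicritical =
  fixes d n :: nat and c :: complex
  assumes d2: "d \<ge> 2" and c0: "c \<noteq> 0" and c2: "d = 2 \<longrightarrow> c \<noteq> -2" and n0: "n > 0"
begin

definition fp :: "complex poly" where "fp = monom 1 d + [:c:]"

definition F :: "complex \<Rightarrow> complex" where "F z = z ^ d + c"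

text \<open>The equation is stated on values, so that iterates of the function \<open>F\<close> can
  be rewritten directly; over the complex numbers it is the polynomial identity.\<close>

definition semiconj :: "complex poly \<Rightarrow> complex poly \<Rightarrow> bool" where
  "semiconj A B \<longleftrightarrow> degree A > 0 \<and> degree B > 0 \<and> (\<forall>x. (F ^^ n) (poly A x) = poly A (poly B x))"

lemma poly_fp: "poly fp = F"
  by (auto simp: fp_def F_def poly_monom)

lemma degree_fp: "degree fp = d"
proof -
  have "degree fp = degree (monom (1::complex) d)"
    unfolding fp_def using d2 by (intro degree_add_eq_left) (simp add: degree_monom_eq)
  then show ?thesis by (simp add: degree_monom_eq)
qed

section \<open>Descent and lifting of solutions\<close>

lemma F_rotate: "z ^ d = 1 \<Longrightarrow> F (z * x) = F x"
  by (simp add: F_def power_mult_distrib)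

lemma F_iter_rotate: "z ^ d = 1 \<Longrightarrow> (F ^^ n) (z * x) = (F ^^ n) x"
  using n0 by (cases n) (simp_all add: F_rotate funpow_Suc_right del: funpow.simps)

text \<open>Cancelling the outer \<open>F\<close> leaves a \<open>d\<close>-th root of unity
  \<open>z\<close>. Replacing \<open>P\<close> by \<open>smult z P\<close> absorbs it, because
  \<open>F ^^ n\<close> with \<open>n > 0\<close> does not see rotations of its argument.\<close>

lemma semiconj_descend:
  assumes "degree P > 0" "degree C > 0" "\<And>x. F ((F ^^ n) (poly P x)) = F (poly P (poly C x))"
  obtains z where "z ^ d = 1" "semiconj (smult z P) C"
proof -
  have "pcompose (piter fp n) P ^ d = pcompose P C ^ d"
    unfolding poly_eq_poly_eq_iff[symmetric] fun_eq_iff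
    using assms(3) by (simp add: poly_pcompose poly_piter poly_fp F_def)
  then obtain z where z: "z ^ d = 1" "pcompose (piter fp n) P = smult z (pcompose P C)"
    using power_eq_power_poly d2 by (metis not_numeral_le_zero not_gr_zero)
  have "(F ^^ n) (poly P x) = z * poly P (poly C x)" for x
    using arg_cong[OF z(2), of "\<lambda>p. poly p x"] by (simp add: poly_pcompose poly_piter poly_fp)
  moreover have "z \<noteq> 0" using z(1) d2 by (auto simp: power_0_left)
  ultimately have "semiconj (smult z P) C"
    using assms z(1) by (simp add: semiconj_def F_iter_rotate)
  then show thesis using that z(1) by blast
qed

text \<open>One step of the induction: either \<open>F\<close> splits off on the left, or
  \<open>A\<close> lifts through \<open>x ^ e + \<alpha>\<close>. The exponent of the linear factor
  is written \<open>k * g\<close>, with \<open>k\<close> already prime to \<open>e\<close>;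
  \<open>z\<close> is the root of unity from the descent.\<close>

lemma semiconj_step:
  assumes "semiconj A B"
  obtains
    (factor) A\<^sub>1 where "semiconj A\<^sub>1 B" "\<And>x. poly A x = F (poly A\<^sub>1 x)"
  | (lift) \<alpha> e g k Q P C z where "d = e * g" "e \<ge> 2" "k > 0" "coprime k e" "Q \<noteq> 0"
      "A = [:-\<alpha>, 1:] ^ (k * g) * Q ^ d + [:c:]" "semiconj P C"
      "\<And>x. F (poly P x) = poly A (x ^ e + \<alpha>)"
      "degree P = k + e * degree Q" "degree A = g * degree P"
      "\<And>x. poly P x = z * x ^ k * poly Q (x ^ e + \<alpha>)"
proof -
  have A: "degree A > 0" "degree B > 0" "\<And>x. (F ^^ n) (poly A x) = poly A (poly B x)"
    using assms by (auto simp: semiconj_def)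
  obtain n' where n': "n = Suc n'" using n0 gr0_implies_Suc by blast
  have d0: "d > 0" using d2 by simp
  \<comment> \<open>The outermost of the \<open>n\<close> applications of \<open>F\<close> supplies
    the \<open>d\<close>-th power.\<close>
  have "pcompose (A - [:c:]) B = pcompose (piter fp n') A ^ d"
    unfolding poly_eq_poly_eq_iff[symmetric] fun_eq_iff
    using A(3) by (simp add: poly_pcompose poly_piter poly_fp n' F_def flip: A(3))
  then obtain \<alpha> k' Q X where AQ: "A - [:c:] = [:-\<alpha>, 1:] ^ k' * Q ^ d"
    and k': "k' = 0 \<or> 0 < k' \<and> k' < d \<and> B = X ^ (d div gcd d k') + [:\<alpha>:]"
    using pcompose_eq_power[OF d0 diff_const_nonzero[OF A(1)] A(2)] by blast
  have AQ': "A = [:-\<alpha>, 1:] ^ k' * Q ^ d + [:c:]" using AQ by (simp add: algebra_simps)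
  have "Q \<noteq> 0" using AQ' A(1) d0 by (auto simp: power_0_left)
  show thesis
  proof (cases "k' = 0")
    case True
    then have AF: "poly A x = F (poly Q x)" for x by (simp add: AQ' F_def)
    have "degree Q > 0"
    proof (rule ccontr)
      assume "\<not> degree Q > 0"
      then obtain q where "Q = [:q:]" by (auto elim: degree_eq_zeroE)
      then show False using A(1) True by (simp add: AQ' poly_const_pow)
    qed
    moreover have "F ((F ^^ n) (poly Q x)) = F (poly Q (poly B x))" for x
      using A(3)[of x] by (simp add: AF funpow_swap1)
    ultimately obtain z where "z ^ d = 1" "semiconj (smult z Q) B"
      using semiconj_descend A(2) by blast
    then show thesis using factor[of "smult z Q"] by (simp add: AF F_rotate)
  next
    case False
    define g where "g = gcd d k'"
    define e where "e = d div g"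
    define k where "k = k' div g"
    have "g > 0" using d0 by (simp add: g_def)
    have dk: "d = e * g" "k' = k * g" by (simp_all add: e_def k_def g_def)
    have "coprime k e" using d0
      by (simp add: e_def k_def g_def coprime_commute div_gcd_coprime)
    have "k > 0" using dk(2) False by (cases "k = 0") auto
    have "e \<noteq> 0" using dk d0 by (cases "e = 0") auto
    moreover have "e \<noteq> 1"
    proof
      assume "e = 1"
      then have "d dvd k'" using dk by simp
      then show False using k' False by (auto dest: dvd_imp_le)
    qed
    ultimately have "e \<ge> 2" by linarith
    have B: "B = X ^ e + [:\<alpha>:]" using k' False by (simp add: e_def g_def)
    let ?E = "monom 1 e + [:\<alpha>:]"
    let ?P = "monom 1 k * pcompose Q ?E"
    let ?C = "pcompose X ?E"
    have E: "poly ?E x = x ^ e + \<alpha>" for x by (simp add: poly_monom)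
    have "degree ?E = degree (monom (1::complex) e)"
      using \<open>e \<ge> 2\<close> by (intro degree_add_eq_left) (simp add: degree_monom_eq)
    then have degE: "degree ?E = e" by (simp add: degree_monom_eq)
    have "degree X > 0"
    proof (rule ccontr)
      assume "\<not> degree X > 0"
      then obtain q where "X = [:q:]" by (auto elim: degree_eq_zeroE)
      then show False using A(2) by (simp add: B poly_const_pow)
    qed
    then have "degree ?C > 0" using degE \<open>e \<ge> 2\<close> by (simp add: degree_pcompose)
    have "pcompose Q ?E \<noteq> 0" using \<open>Q \<noteq> 0\<close> degE \<open>e \<ge> 2\<close> 
      by (metis pcompose_eq_0 not_numeral_le_zero not_gr_zero)
    then have degP: "degree ?P = k + e * degree Q"
      by (simp add: degree_mult_eq degree_monom_eq degree_pcompose degE monom_eq_0_iff)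
    have P: "poly ?P x = x ^ k * poly Q (x ^ e + \<alpha>)" for x
      by (simp add: poly_monom poly_pcompose)
    have FP: "F (poly ?P x) = poly A (x ^ e + \<alpha>)" for x
      unfolding P F_def AQ' using dk
      by (simp add: power_mult_distrib mult_ac flip: power_mult)
    \<comment> \<open>\<open>B = X ^ e + \<alpha>\<close> makes \<open>x ^ e + \<alpha>\<close> a
      semiconjugacy from \<open>?C\<close> to \<open>B\<close>, so the equation for \<open>A\<close>
      pulls back to \<open>?P\<close>.\<close>
    have "F ((F ^^ n) (poly ?P x)) = F (poly ?P (poly ?C x))" for x
    proof -
      have "F ((F ^^ n) (poly ?P x)) = (F ^^ n) (F (poly ?P x))" by (simp add: funpow_swap1)
      also have "\<dots> = poly A (poly B (x ^ e + \<alpha>))" by (simp only: FP A(3))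
      also have "poly B (x ^ e + \<alpha>) = poly ?C x ^ e + \<alpha>" by (simp add: B poly_pcompose poly_monom)
      also have "poly A \<dots> = F (poly ?P (poly ?C x))" by (simp only: FP)
      finally show ?thesis .
    qed
    moreover have "degree ?P > 0" using degP \<open>k > 0\<close> by simp
    ultimately obtain z where z: "z ^ d = 1" "semiconj (smult z ?P) ?C"
      using semiconj_descend \<open>degree ?C > 0\<close> by blast
    have "z \<noteq> 0" using z(1) d0 by (auto simp: power_0_left)
    have degA: "degree A = g * degree ?P"
    proof -
      have "pcompose A ?E = pcompose fp ?P"
        unfolding poly_eq_poly_eq_iff[symmetric] fun_eq_iff
        by (simp only: poly_pcompose[of _ ?E] poly_pcompose[of _ ?P] E poly_fp FP) simp
      then have "degree (pcompose A ?E) = degree (pcompose fp ?P)" by (rule arg_cong)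
      then have "degree A * e = d * degree ?P"
        by (simp only: degree_pcompose degE degree_fp)
      also have "\<dots> = g * degree ?P * e" by (simp only: dk(1) mult_ac)
      finally show ?thesis using \<open>e \<noteq> 0\<close> by simp
    qed
    show thesis
    proof (rule lift[of e g k Q \<alpha> "smult z ?P" ?C z])
      show "F (poly (smult z ?P) x) = poly A (x ^ e + \<alpha>)" for x
        unfolding poly_smult using z(1) FP by (simp only: F_rotate)
      show "A = [:-\<alpha>, 1:] ^ (k * g) * Q ^ d + [:c:]" using AQ' unfolding dk(2) .
      show "degree (smult z ?P) = k + e * degree Q" "degree A = g * degree (smult z ?P)"
        using degP degA \<open>z \<noteq> 0\<close> by (simp_all only: degree_smult_eq if_False)
      show "poly (smult z ?P) x = z * x ^ k * poly Q (x ^ e + \<alpha>)" for x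
        unfolding poly_smult P by (rule mult.assoc[symmetric])
    qed (fact dk(1) \<open>e \<ge> 2\<close> \<open>k > 0\<close> \<open>coprime k e\<close> \<open>Q \<noteq> 0\<close> z(2))+
  qed
qed

section \<open>Solutions of degree coprime to \<open>d\<close>\<close>

text \<open>Splitting off \<open>F\<close> would make \<open>d\<close> divide the degree, so
  \<open>P\<close> lifts; \<open>g\<close> divides both the degree and \<open>d\<close>, hence
  \<open>g = 1\<close> and \<open>e = d\<close>. The fibre over \<open>c\<close> consists of
  \<alpha> and the roots of \<open>Q\<close>.\<close>

lemma semiconj_lift_coprime:
  assumes "semiconj P C" "coprime (degree P) d"
  obtains \<alpha> j q P' C' where "0 < j" "degree P = j + d * q" "card {x. poly P x = c} \<le> Suc q"
    "semiconj P' C'" "degree P' = degree P" "\<And>x. F (poly P' x) = poly P (x ^ d + \<alpha>)"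
    "coprime j d" "\<And>w x. w ^ d = 1 \<Longrightarrow> poly P' (w * x) = w ^ j * poly P' x"
  using assms(1)
proof (cases rule: semiconj_step)
  case (factor A\<^sub>1)
  have "P = pcompose fp A\<^sub>1"
    unfolding poly_eq_poly_eq_iff[symmetric] fun_eq_iff using factor(2) by (simp add: poly_pcompose poly_fp)
  then have "d dvd degree P" by (simp add: degree_pcompose degree_fp)
  then have "d = 1" using assms(2) by (simp add: coprime_absorb_right)
  then show ?thesis using d2 by simp
next
  case (lift \<alpha> e g k Q P' C' z)
  have "g dvd degree P" "g dvd d" using lift by simp_all
  then have g: "g = 1" using assms(2) by (meson coprime_def nat_dvd_1_iff_1)
  then have e: "e = d" using lift by simp
  have "poly P x = c \<longleftrightarrow> x = \<alpha> \<or> poly Q x = 0" for x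
    using lift(3) d2 unfolding lift(6) by (auto simp: g)
  then have "{x. poly P x = c} = insert \<alpha> {x. poly Q x = 0}" by auto
  then have "card {x. poly P x = c} \<le> Suc (card {x. poly Q x = 0})"
    by (simp add: card_insert_le_m1)
  also have "card {x. poly Q x = 0} \<le> degree Q" using \<open>Q \<noteq> 0\<close> by (rule card_poly_roots_bound)
  finally have card: "card {x. poly P x = c} \<le> Suc (degree Q)" by simp
  have rot: "poly P' (w * x) = w ^ k * poly P' x" if "w ^ d = 1" for w x
    using that by (simp add: lift(11) e power_mult_distrib)
  show ?thesis
  proof (rule that[of k "degree Q" P' C' \<alpha>])
    show "degree P = k + d * degree Q" "degree P' = degree P" using lift(9,10) by (simp_all add: g e)
    show "F (poly P' x) = poly P (x ^ d + \<alpha>)" for x using lift(8) by (simp add: e)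
    show "coprime k d" using lift(4) by (simp add: e)
  qed (fact lift(3) card lift(7) rot)+
qed

text \<open>Lifting \<open>P\<close> bounds its fibre over \<open>c\<close>; the symmetry of
  \<open>P\<close> spreads the bound to all \<open>d\<close> values \<open>v\<close> with
  \<open>v ^ d = c ^ d\<close>. Then \<open>card_fibres\<close> leaves only
  \<open>d = 2\<close>.\<close>

lemma rotational_semiconj:
  assumes "semiconj P C" "coprime (degree P) d" "degree P > 1" "k > 0" "coprime k d"
    and rot: "\<And>w x. w ^ d = 1 \<Longrightarrow> poly P (w * x) = w ^ k * poly P x"
  shows "d = 2" "v\<^sup>2 = c\<^sup>2 \<Longrightarrow> 2 * card {x. poly P x = v} \<le> degree P + 1"
proof -
  obtain j q where j: "0 < j" and deg: "degree P = j + d * q" and card: "card {x. poly P x = c} \<le> Suc q"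
    using semiconj_lift_coprime[OF assms(1,2)] by metis
  have fin: "finite {x. poly P x = v}" for v using assms(3) by (intro finite_fibre) simp
  have cardv: "card {x. poly P x = v} \<le> Suc q" if "v ^ d = c ^ d" for v
  proof -
    have "(v / c) ^ d = 1" using that c0 by (simp add: power_divide)
    then obtain u where u: "u ^ d = 1" "u ^ k = v / c"
      using root_of_unity_power_coprime[OF assms(5,4)] by metis
    have "u \<noteq> 0" using u(1) d2 by (auto simp: power_0_left)
    then have "card {x. poly P x = u ^ k * c} \<le> card {x. poly P x = c}"
      using rot[OF u(1)] fin by (intro fibre_rotate) auto
    then show ?thesis using card c0 by (simp add: u(2))
  qed
  define V where "V = {v. v ^ d = c ^ d}"
  have "V = (*) c ` {z. z ^ d = 1}"
  proof
    show "V \<subseteq> (*) c ` {z. z ^ d = 1}"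
    proof
      fix v assume "v \<in> V"
      then show "v \<in> (*) c ` {z. z ^ d = 1}"
        using c0 by (intro image_eqI[of _ _ "v / c"]) (auto simp: V_def power_divide)
    qed
  qed (auto simp: V_def power_mult_distrib)
  then have V: "finite V" "card V = d"
    using c0 d2 by (auto simp: card_image inj_on_def card_roots_unity_eq finite_roots_unity)
  have "d * degree P < (\<Sum>v\<in>V. card {x. poly P x = v}) + degree P"
    using card_fibres[of P V] assms(3) V by simp
  also have "(\<Sum>v\<in>V. card {x. poly P x = v}) \<le> d * Suc q"
    using sum_bounded_above[of V "\<lambda>v. card {x. poly P x = v}" "Suc q"] cardv V by (simp add: V_def)
  finally have less: "d * degree P + j < 2 * degree P + d" using deg by simp
  show "d = 2"
  proof (rule ccontr)
    assume "d \<noteq> 2"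
    \<comment> \<open>In terms of \<open>r\<close> and \<open>s\<close> the inequality reads
      \<open>r * s + r + s + j < 1\<close>, against \<open>j > 0\<close>.\<close>
    then obtain r where r: "d = r + 3" using d2 by (metis add.commute le_Suc_ex eval_nat_numeral(3) le_antisym not_less_eq_eq)
    obtain s where s: "degree P = s + 2" using assms(3) by (metis add.commute le_Suc_ex Suc_1 Suc_leI)
    show False using less j by (simp add: r s algebra_simps)
  qed
  then show "2 * card {x. poly P x = v} \<le> degree P + 1" if "v\<^sup>2 = c\<^sup>2"
    using cardv[of v] that deg j by simp
qed

text \<open>Two lifts of a solution of degree prime to \<open>d\<close> are rotational. For \<open>d = 2\<close> the critical
  values of both are exactly \<open>\<plusminus>c\<close>, as for a Chebyshev polynomial, and \<open>f \<circ> P\<^sub>2 = P\<^sub>1 \<circ> (x\<^sup>2 + \<beta>)\<close>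
  then forces \<open>-c \<in> {f(0), f(c)}\<close>.\<close>

lemma semiconj_coprime_imp_linear:
  assumes "semiconj A B" "coprime (degree A) d"
  shows "degree A = 1"
proof (rule ccontr)
  assume "degree A \<noteq> 1"
  moreover have "degree A > 0" using assms(1) by (simp add: semiconj_def)
  ultimately have deg: "degree A > 1" by linarith
  obtain j\<^sub>1 P\<^sub>1 C\<^sub>1 where P\<^sub>1: "0 < j\<^sub>1" "coprime j\<^sub>1 d" "semiconj P\<^sub>1 C\<^sub>1" "degree P\<^sub>1 = degree A"
    "\<And>w x. w ^ d = 1 \<Longrightarrow> poly P\<^sub>1 (w * x) = w ^ j\<^sub>1 * poly P\<^sub>1 x"
    using semiconj_lift_coprime[OF assms] by metis
  have cop1: "coprime (degree P\<^sub>1) d" and deg1: "degree P\<^sub>1 > 1" using P\<^sub>1(4) deg assms(2) by simp_all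
  obtain j\<^sub>2 P\<^sub>2 C\<^sub>2 \<beta> where P\<^sub>2: "0 < j\<^sub>2" "coprime j\<^sub>2 d" "semiconj P\<^sub>2 C\<^sub>2" "degree P\<^sub>2 = degree P\<^sub>1"
    "\<And>w x. w ^ d = 1 \<Longrightarrow> poly P\<^sub>2 (w * x) = w ^ j\<^sub>2 * poly P\<^sub>2 x"
    "\<And>x. F (poly P\<^sub>2 x) = poly P\<^sub>1 (x ^ d + \<beta>)"
    using semiconj_lift_coprime[OF P\<^sub>1(3) cop1] by metis
  have cop2: "coprime (degree P\<^sub>2) d" and deg2: "degree P\<^sub>2 > 1" using P\<^sub>2(4) cop1 deg1 by simp_all
  note R\<^sub>1 = rotational_semiconj[OF P\<^sub>1(3) cop1 deg1 P\<^sub>1(1,2,5)]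
  note R\<^sub>2 = rotational_semiconj[OF P\<^sub>2(3) cop2 deg2 P\<^sub>2(1,2,5)]
  have d: "d = 2" by (rule R\<^sub>1(1))
  have "odd (degree P\<^sub>1)" using cop1 by (simp add: d coprime_right_2_iff_odd)
  then have "degree P\<^sub>1 \<noteq> 2" by auto
  then have "card {x. poly P\<^sub>1 x = -c} < degree P\<^sub>1" using R\<^sub>1(2)[of "-c"] deg1 by simp
  then obtain y where y: "poly P\<^sub>1 y = -c" "poly (pderiv P\<^sub>1) y = 0"
    using card_fibre_less_imp_critical[of P\<^sub>1 "-c"] deg1 by auto
  \<comment> \<open>A preimage of the critical point \<open>y\<close> under
    \<open>x ^ d + \<beta>\<close>; the chain rule then makes \<open>w\<close> critical for
    \<open>fp\<close> composed with \<open>P\<^sub>2\<close>.\<close>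
  obtain w where w: "w ^ d = y - \<beta>" using nth_root_exists[of d "y - \<beta>"] d2 by auto
  have "pcompose fp P\<^sub>2 = pcompose P\<^sub>1 (monom 1 d + [:\<beta>:])"
    unfolding poly_eq_poly_eq_iff[symmetric] fun_eq_iff
    using P\<^sub>2(6) by (simp add: poly_pcompose poly_fp poly_monom)
  then have "poly (pderiv (pcompose fp P\<^sub>2)) w = poly (pderiv (pcompose P\<^sub>1 (monom 1 d + [:\<beta>:]))) w"
    by simp
  then have "poly (pderiv fp) (poly P\<^sub>2 w) * poly (pderiv P\<^sub>2) w = 0"
    by (simp add: pderiv_pcompose poly_pcompose poly_monom w y(2))
  moreover have "poly (pderiv fp) v = of_nat d * v ^ (d - 1)" for v
    by (simp add: fp_def pderiv_add pderiv_monom poly_monom pderiv_pCons)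
  ultimately have "poly P\<^sub>2 w = 0 \<or> poly (pderiv P\<^sub>2) w = 0"
    using d2 by auto
  moreover have FP: "(poly P\<^sub>2 w)\<^sup>2 + c = -c"
    using P\<^sub>2(6)[of w] y(1) w unfolding F_def by (simp add: d)
  moreover have "-c \<noteq> c" using c0 by (simp add: neg_equal_zero)
  ultimately have crit: "poly (pderiv P\<^sub>2) w = 0" by auto
  let ?v = "poly P\<^sub>2 w"
  \<comment> \<open>The fibres over \<open>c\<close> and \<open>-c\<close> have at most
    \<open>degree P\<^sub>2 + 1\<close> points together, which leaves no room for a third critical
    value.\<close>
  have "?v = c \<or> ?v = -c"
  proof (rule ccontr)
    assume "\<not> ?thesis"
    then have "3 * degree P\<^sub>2 < card {x. poly P\<^sub>2 x = c} + card {x. poly P\<^sub>2 x = -c}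
        + card {x. poly P\<^sub>2 x = ?v} + degree P\<^sub>2"
      using card_fibres[of P\<^sub>2 "{c, -c, ?v}"] deg2 \<open>-c \<noteq> c\<close> by (auto simp: add.assoc)
    moreover have "card {x. poly P\<^sub>2 x = ?v} < degree P\<^sub>2"
      using deg2 crit by (intro card_fibre_critical) auto
    ultimately show False using R\<^sub>2(2)[of c] R\<^sub>2(2)[of "-c"] by simp
  qed
  then have "c\<^sup>2 + c = -c" using FP by auto
  then have "c * (c + 2) = 0" by (simp add: power2_eq_square algebra_simps)
  then show False using c0 c2 d by (auto simp: add_eq_0_iff2)
qed

section \<open>Standard forms and the induction on the degree\<close>

definition F_div :: "nat \<Rightarrow> complex \<Rightarrow> complex" where
  "F_div \<delta> z = (z ^ \<delta> + c) ^ (d div \<delta>)"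

text \<open>Here \<open>a * x + b\<close> is the linear polynomial L; the condition on
  \<open>B\<close> is conjugacy by L, written without its inverse.\<close>

definition standard_form :: "complex poly \<Rightarrow> complex poly \<Rightarrow> nat \<Rightarrow> nat \<Rightarrow> complex \<Rightarrow> complex \<Rightarrow> bool" where
  "standard_form A B m \<delta> a b \<longleftrightarrow> \<delta> > 0 \<and> \<delta> dvd d \<and> a \<noteq> 0
    \<and> (\<forall>x. poly A x = (F ^^ m) ((a * x + b) ^ \<delta> + c))
    \<and> (\<forall>x. a * poly B x + b = (F_div \<delta> ^^ n) (a * x + b))"

text \<open>The map \<open>y ^ \<delta> + c\<close> semiconjugates \<open>F_div \<delta>\<close> to
  \<open>F\<close>.\<close>

lemma F_iter_power_add:
  assumes "\<delta> dvd d"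
  shows "(F ^^ i) (y ^ \<delta> + c) = (F_div \<delta> ^^ i) y ^ \<delta> + c"
proof -
  have "F (z ^ \<delta> + c) = F_div \<delta> z ^ \<delta> + c" for z
    using assms by (simp add: F_def F_div_def flip: power_mult)
  then show ?thesis by (induction i) simp_all
qed

lemma F_div_iter_rotate: "z ^ \<delta> = 1 \<Longrightarrow> (F_div \<delta> ^^ n) (z * x) = (F_div \<delta> ^^ n) x"
  using n0 by (cases n) (simp_all add: F_div_def power_mult_distrib funpow_Suc_right del: funpow.simps)

text \<open>The equation determines the linear polynomial after \<open>B\<close> only up to a
  \<open>g\<close>-th root of unity \<open>z\<close>. Dividing \<open>a\<close> and \<open>b\<close>
  by \<open>z\<close> removes it and changes neither \<open>A\<close> nor the iterate of
  \<open>F_div g\<close>.\<close>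

lemma standard_form_linear:
  assumes AB: "semiconj A B" and A: "\<And>x. poly A x = (a * x + b) ^ g + c"
    and "a \<noteq> 0" "g > 0" "g dvd d"
  shows "\<exists>a b. standard_form A B 0 g a b"
proof -
  let ?L = "[:b, a:]"
  let ?G = "piter ((monom 1 g + [:c:]) ^ (d div g)) n"
  have "poly ((monom 1 g + [:c:]) ^ (d div g)) = F_div g"
    by (auto simp: F_div_def poly_monom)
  then have G: "poly ?G x = (F_div g ^^ n) x" for x by (simp add: poly_piter)
  have "(a * poly B x + b) ^ g = (F_div g ^^ n) (a * x + b) ^ g" for x
    using AB F_iter_power_add[OF assms(5)] by (simp add: semiconj_def A)
  then have "pcompose ?L B ^ g = pcompose ?G ?L ^ g"
    unfolding poly_eq_poly_eq_iff[symmetric] fun_eq_iff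
    by (simp add: poly_pcompose G algebra_simps)
  then obtain z where z: "z ^ g = 1" "pcompose ?L B = smult z (pcompose ?G ?L)"
    using power_eq_power_poly assms(4) by blast
  have B: "a * poly B x + b = z * (F_div g ^^ n) (a * x + b)" for x
    using arg_cong[OF z(2), of "\<lambda>p. poly p x"] by (simp add: poly_pcompose G algebra_simps)
  have "z \<noteq> 0" using z(1) assms(4) by (auto simp: power_0_left)
  have lin: "a / z * x + b / z = inverse z * (a * x + b)" for x
    by (simp add: divide_inverse algebra_simps)
  have iz: "inverse z ^ g = 1" using z(1) by (simp add: power_inverse)
  have "standard_form A B 0 g (a / z) (b / z)"
    unfolding standard_form_def lin
    using assms \<open>z \<noteq> 0\<close> iz by (simp add: F_div_iter_rotate[OF iz] B A power_mult_distrib)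
  then show ?thesis by blast
qed

lemma semiconj_standard_form:
  assumes "semiconj A B"
  shows "\<exists>m \<delta> a b. standard_form A B m \<delta> a b"
  using assms
proof (induction "degree A" arbitrary: A B rule: less_induct)
  case less
  from less.prems show ?case
  proof (cases rule: semiconj_step)
    case (factor A\<^sub>1)
    have "A = pcompose fp A\<^sub>1"
      unfolding poly_eq_poly_eq_iff[symmetric] fun_eq_iff using factor(2) by (simp add: poly_pcompose poly_fp)
    then have "degree A = d * degree A\<^sub>1" by (simp add: degree_pcompose degree_fp)
    moreover have "degree A\<^sub>1 > 0" using factor(1) by (simp add: semiconj_def)
    ultimately have "degree A\<^sub>1 < degree A" using d2 by simp
    then obtain m \<delta> a b where "standard_form A\<^sub>1 B m \<delta> a b" using less.hyps factor(1) by blast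
    then have "standard_form A B (Suc m) \<delta> a b"
      using factor(2) by (simp add: standard_form_def)
    then show ?thesis by blast
  next
    case (lift \<alpha> e g k Q P C z)
    have cop: "coprime (degree P) e"
    proof -
      have "gcd (k + e * degree Q) e = gcd k e" by (metis gcd_add_mult add.commute gcd.commute mult.commute)
      then show ?thesis using lift(4,9) by (simp add: coprime_iff_gcd_eq_1)
    qed
    have "g > 0" using lift(1) d2 by (cases "g = 0") auto
    show ?thesis
    proof (cases "g = 1")
      case True
      then have "coprime (degree A) d" using cop lift by simp
      then have "degree A = 1" by (rule semiconj_coprime_imp_linear[OF less.prems])
      then obtain a b where "A = [:b, a:]" "a \<noteq> 0"
        by (metis One_nat_def degree_eq_zeroE degree_pCons_eq_if nat.inject pCons_cases pCons_eq_0_iff zero_neq_one)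
      \<comment> \<open>For \<delta> = 1 the linear polynomial is \<open>A - c\<close>, hence the
        shift \<open>b - c\<close>.\<close>
      then have "\<exists>a b. standard_form A B 0 1 a b"
        using less.prems by (intro standard_form_linear[of _ _ a "b - c"]) (auto simp: algebra_simps)
      then show ?thesis by blast
    next
      case False
      have "degree P > 0" using lift(7) by (simp add: semiconj_def)
      then have "degree P < degree A" using lift(10) \<open>g > 0\<close> False by simp
      then obtain m \<delta> a b where "standard_form P C m \<delta> a b" using less.hyps lift(7) by blast
      then have P: "\<delta> > 0" "a \<noteq> 0" "\<And>x. poly P x = (F ^^ m) ((a * x + b) ^ \<delta> + c)"
        by (auto simp: standard_form_def)
      have "P = pcompose (piter fp m) ([:b, a:] ^ \<delta> + [:c:])"
        unfolding poly_eq_poly_eq_iff[symmetric] fun_eq_iff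
        using P(3) by (simp add: poly_pcompose poly_piter poly_fp algebra_simps)
      moreover have "degree ([:b, a:] ^ \<delta> + [:c:]) = \<delta>"
        using P by (subst degree_add_eq_left) (simp_all add: degree_power_eq)
      ultimately have degP: "degree P = d ^ m * \<delta>"
        by (simp add: degree_pcompose degree_piter degree_fp)
      \<comment> \<open>Otherwise \<open>e\<close>, a divisor of \<open>d\<close>, divides
        \<open>degree P\<close>, to which it is coprime.\<close>
      have "m = 0"
      proof (rule ccontr)
        assume "m \<noteq> 0"
        then have "e dvd d ^ m" using lift(1) by (cases m) simp_all
        then have "e dvd degree P" by (simp add: degP)
        then have "e = 1" using cop by (simp add: coprime_absorb_right)
        then show False using lift(2) by simp
      qed
      then have P': "poly P x = (a * x + b) ^ \<delta> + c" "degree P = \<delta>" for x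
        using P(3) degP by simp_all
      \<comment> \<open>\<open>P\<close> has at most one point over \<open>c\<close>, and by
        symmetry at most one over \<open>w ^ k * c\<close>, a different value; two such fibres force
        degree 1.\<close>
      have "\<delta> = 1"
      proof -
        have "card {w::complex. w ^ e = 1} \<noteq> card {1::complex}"
          using lift(2) by (simp add: card_roots_unity_eq)
        moreover have "{1::complex} \<subseteq> {w. w ^ e = 1}" by simp
        ultimately obtain w :: complex where w: "w ^ e = 1" "w \<noteq> 1"
          by (metis (mono_tags, lifting) mem_Collect_eq singletonI subsetI subset_antisym singletonD)
        have "w \<noteq> 0" using w(1) lift(2) by (auto simp: power_0_left)
        have wk: "w ^ k \<noteq> 1"
          using root_of_unity_power_coprime[OF lift(4,3) w(1)] w(2) by metis
        have fin: "finite {x. poly P x = c}" using \<open>degree P > 0\<close> by (rule finite_fibre)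
        have "x = - b / a" if "poly P x = c" for x
        proof -
          have "a * x = - b" using that P(1) by (simp add: P'(1) eq_neg_iff_add_eq_0)
          then show ?thesis using P(2) by (metis nonzero_mult_div_cancel_left)
        qed
        then have "card {x. poly P x = c} \<le> card {- b / a}" by (intro card_mono) auto
        then have "card {x. poly P x = c} \<le> 1" by simp
        moreover have "card {x. poly P x = w ^ k * c} \<le> card {x. poly P x = c}"
          using \<open>w \<noteq> 0\<close> fin w(1) by (intro fibre_rotate) (auto simp: lift(11) power_mult_distrib)
        moreover have "2 * degree P < card {x. poly P x = c} + card {x. poly P x = w ^ k * c} + degree P"
          using card_fibres[OF \<open>degree P > 0\<close>, of "{c, w ^ k * c}"] wk c0 by simp
        ultimately show ?thesis using P'(2) P(1) by simp
      qed
      then have "k + e * degree Q = 1" using lift(9) P'(2) by simp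
      then have "k = 1" "degree Q = 0" using lift(2,3) by (auto simp: add_is_1)
      then obtain q where q: "Q = [:q:]" by (auto elim: degree_eq_zeroE)
      then have "q \<noteq> 0" using lift(5) by simp
      have "poly A x = (q ^ e * x + - (q ^ e * \<alpha>)) ^ g + c" for x
      proof -
        \<comment> \<open>As \<open>d = e * g\<close>, the constant \<open>q ^ d\<close> is a
          \<open>g\<close>-th power and moves into the linear factor.\<close>
        have "poly A x = (x - \<alpha>) ^ g * (q ^ e) ^ g + c"
          unfolding lift(6) by (simp add: \<open>k = 1\<close> q flip: power_mult lift(1))
        also have "\<dots> = (q ^ e * x + - (q ^ e * \<alpha>)) ^ g + c"
          by (simp add: algebra_simps flip: power_mult_distrib)
        finally show ?thesis .
      qed
      then have "\<exists>a b. standard_form A B 0 g a b"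
        using less.prems \<open>q \<noteq> 0\<close> \<open>g > 0\<close> lift(1)
        by (intro standard_form_linear[of _ _ "q ^ e" "- (q ^ e * \<alpha>)"]) auto
      then show ?thesis by blast
    qed
  qed
qed

end

section \<open>From values back to polynomial compositions\<close>

theorem theorem7p1:
  fixes d n :: nat and c :: complex and A B :: "complex poly"
  defines "f \<equiv> monom 1 d + [:c:]"
  assumes "d \<ge> 2"
    and "c \<noteq> 0" and "d = 2 \<longrightarrow> c \<noteq> -2"
    and "n > 0"
    and "degree A > 0" and "degree B > 0"
    and "pcompose (piter f n) A = pcompose A B"
  shows "\<exists>m \<delta> L Linv. \<delta> > 0 \<and> \<delta> dvd d \<and> degree L = 1
           \<and> pcompose L Linv = [:0, 1:] \<and> pcompose Linv L = [:0, 1:]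
           \<and> A = pcompose (piter f m) (pcompose (monom 1 \<delta> + [:c:]) L)
           \<and> B = pcompose Linv (pcompose (piter ((monom 1 \<delta> + [:c:]) ^ (d div \<delta>)) n) L)"
proof -
  interpret unicritical d n c using assms by unfold_locales
  have f: "f = fp" by (simp add: f_def fp_def)
  have "(F ^^ n) (poly A x) = poly A (poly B x)" for x
    using arg_cong[OF assms(8), of "\<lambda>p. poly p x"] by (simp add: poly_pcompose poly_piter f poly_fp)
  then have "semiconj A B" using assms by (simp add: semiconj_def)
  then obtain m \<delta> a b where "standard_form A B m \<delta> a b" using semiconj_standard_form by blast
  then have \<delta>: "\<delta> > 0" "\<delta> dvd d" "a \<noteq> 0" and A: "\<And>x. poly A x = (F ^^ m) ((a * x + b) ^ \<delta> + c)"
    and B: "\<And>x. a * poly B x + b = (F_div \<delta> ^^ n) (a * x + b)"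
    by (auto simp: standard_form_def)
  let ?L = "[:b, a:]" and ?Linv = "[:- b / a, 1 / a:]"
  have "poly ((monom 1 \<delta> + [:c:]) ^ (d div \<delta>)) = F_div \<delta>"
    by (auto simp: F_div_def poly_monom)
  then have G: "poly (piter ((monom 1 \<delta> + [:c:]) ^ (d div \<delta>)) n) x = (F_div \<delta> ^^ n) x" for x
    by (simp only: poly_piter)
  have LL: "pcompose ?L ?Linv = [:0, 1:]" "pcompose ?Linv ?L = [:0, 1:]"
    using \<delta>(3) by (simp_all add: pcompose_pCons)
  have "A = pcompose (piter f m) (pcompose (monom 1 \<delta> + [:c:]) ?L)"
    unfolding poly_eq_poly_eq_iff[symmetric] fun_eq_iff
    by (simp add: A poly_pcompose poly_piter f poly_fp poly_monom algebra_simps)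
  moreover have "B = pcompose ?Linv (pcompose (piter ((monom 1 \<delta> + [:c:]) ^ (d div \<delta>)) n) ?L)"
  proof -
    have "pcompose ?L B = pcompose (piter ((monom 1 \<delta> + [:c:]) ^ (d div \<delta>)) n) ?L"
      unfolding poly_eq_poly_eq_iff[symmetric] fun_eq_iff
      using B by (simp add: poly_pcompose G algebra_simps)
    then have "pcompose ?Linv (pcompose (piter ((monom 1 \<delta> + [:c:]) ^ (d div \<delta>)) n) ?L)
        = pcompose (pcompose ?Linv ?L) B"
      by (metis pcompose_assoc)
    then show ?thesis by (simp only: LL) (simp add: pcompose_pCons)
  qed
  moreover have "degree ?L = 1" using \<delta>(3) by simp
  ultimately show ?thesis using \<delta> LL by blast
qed

end
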